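(* The following series identity holds: $$\sum_{k=0}^{\infty}\left(\frac{-1}{4}\right)^k\frac{(1)_k^3(\frac{1}{2})_k}{(\frac{5}{4})_k^2(\frac{7}{4})_k^2}\left\{(19+56k+40k^2)\left[H_{k}^{(2)}+H_{1+2k}^{(2)}-4H_{3+4k}^{(2)}\right]+4\right\}=-72\beta(4).$$
   Context: For a complex number $x$ and a nonnegative integer $n$, the shifted factorial is $(x)_0=1$ and $(x)_n=x(x+1)\cdots(x+n-1)$ for $n\ge 1$; $(x)_n^m$ denotes $((x)_n)^m$. The harmonic numbers of order 2 are $H_n^{(2)}=\sum_{j=1}^n \frac{1}{j^2}$, with $H_0^{(2)}=0$. The constant $\beta(4)$ is $\beta(4)=\sum_{k=0}^{\infty}\frac{(-1)^k}{(1+2k)^4}$. *)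

theory Defs
  imports Complex_Main
begin

definition harm2 :: "nat \<Rightarrow> real" where
  "harm2 n = (\<Sum>j=1..n. 1 / real j ^ 2)"

definition dirichlet_beta :: "nat \<Rightarrow> real" where
  "dirichlet_beta s = (\<Sum>k. (-1) ^ k / real (1 + 2 * k) ^ s)"

end

(* The identity is the coefficient of t^2 in
     sum_n (-1)^n / ((n + 1/2)^2 - t^2) = sum_k G(0,k),
   which follows from the WZ pair
     F(n,k) = (-1)^(n+k) (2k)! prod_{i=1..k} (i^2 - t^2) / prod_{j=n..n+2k} ((j + 1/2)^2 - t^2),
     G(n,k) = F(n,k) (q - t^2/2) / ((n + 2k + 3/2)^2 - t^2),
   with q the quadratic polynomial wz_poly (n + 1/2) k, and F(n,k) - F(n,k+1) = G(n,k) - G(n+1,k).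
   Both sides are expanded to first order in t^2 beforehand, so no differentiation of series is
   needed: wz_F and wz_G are the t^2-coefficients of F and G, without the sign (-1)^n, as functions
   of x = n + 1/2. *)
theory Submission
  imports Defs
begin

section \<open>Summation by a WZ pair\<close>

text \<open>Summing the WZ equation over \<open>n\<close> telescopes its right side to
  \<open>G 0 k\<close>, so \<open>G 0 k\<close> is the difference of two consecutive column sums of
  \<open>F\<close>. A second telescoping, over \<open>k\<close>, leaves only the column sum at
  \<open>k = 0\<close>, provided that the column sums tend to 0. The product form of the bound on
  \<open>F\<close> gives both the convergence of each column and this limit.\<close>

lemma wz_sums:
  fixes F G :: "nat \<Rightarrow> nat \<Rightarrow> real" and a b :: "nat \<Rightarrow> real"
  assumes wz: "\<And>n k. F n k - F n (Suc k) = G n k - G (Suc n) k"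
    and bound: "\<And>n k. \<bar>F n k\<bar> \<le> a n * b k"
    and a: "summable a" and b: "b \<longlonglongrightarrow> 0"
    and G: "\<And>k. (\<lambda>n. G n k) \<longlonglongrightarrow> 0"
  shows "(\<lambda>k. G 0 k) sums (\<Sum>n. F n 0)"
proof -
  define S where "S k = (\<Sum>n. F n k)" for k
  have sab: "summable (\<lambda>n. a n * b k)" for k
    using a by (rule summable_mult2)
  have abs: "summable (\<lambda>n. \<bar>F n k\<bar>)" for k
    by (rule summable_comparison_test'[OF sab[of k], of 0]) (simp add: bound)
  have Fs: "(\<lambda>n. F n k) sums S k" for k
    unfolding S_def by (rule summable_sums[OF summable_rabs_cancel[OF abs]])
  have step: "G 0 k = S k - S (Suc k)" for k
  proof -
    have "(\<lambda>n. G n k - G (Suc n) k) sums (G 0 k - 0)"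
      by (rule telescope_sums'[OF G])
    moreover have "(\<lambda>n. G n k - G (Suc n) k) sums (S k - S (Suc k))"
      using sums_diff[OF Fs[of k] Fs[of "Suc k"]] by (simp add: wz)
    ultimately show ?thesis
      using sums_unique2 by fastforce
  qed
  have Sb: "norm (S k) \<le> suminf a * b k" for k
  proof -
    have "\<bar>S k\<bar> \<le> (\<Sum>n. \<bar>F n k\<bar>)"
      unfolding S_def by (rule summable_rabs[OF abs])
    also have "\<dots> \<le> (\<Sum>n. a n * b k)"
      by (rule suminf_le[OF _ abs sab]) (rule bound)
    also have "\<dots> = suminf a * b k"
      using suminf_mult2[OF a] by simp
    finally show ?thesis by simp
  qed
  have "(\<lambda>k. suminf a * b k) \<longlonglongrightarrow> 0"
    using tendsto_mult_right_zero[OF b] by simp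
  then have "S \<longlonglongrightarrow> 0"
    by (rule tendsto_0_le[where K = 1])
      (use order_trans[OF Sb abs_ge_self] in simp)
  then have "(\<lambda>k. S k - S (Suc k)) sums (S 0 - 0)"
    by (rule telescope_sums')
  then show ?thesis
    by (simp add: step S_def)
qed

section \<open>The WZ pair in its second-order coefficients\<close>

definition shifted_sum2 :: "real \<Rightarrow> nat \<Rightarrow> real" where
  "shifted_sum2 x m = (\<Sum>j<m. 1 / (x + real j)^2)"

lemma shifted_sum2_Suc:
  "shifted_sum2 x (Suc m) = shifted_sum2 x m + 1 / (x + real m)^2"
  by (simp add: shifted_sum2_def)

lemma shifted_sum2_rec:
  "shifted_sum2 x (Suc m) = 1 / x^2 + shifted_sum2 (x + 1) m"
  unfolding shifted_sum2_def by (subst sum.lessThan_Suc_shift) (simp add: add_ac)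

lemma harm2_Suc: "harm2 (Suc n) = harm2 n + 1 / (real n + 1)^2"
  by (simp add: harm2_def add_ac)

text \<open>At x = 1/2 the terms are 4 / (2 j + 1)^2. The sum over odd denominators is the full sum
  \<open>harm2 (2 * m + 1)\<close> minus its even part, and that part is
  \<open>harm2 m / 4\<close>.\<close>

lemma shifted_sum2_half:
  "shifted_sum2 (1/2) (Suc m) = 4 * harm2 (2 * m + 1) - harm2 m"
proof (induction m)
  case 0
  show ?case by (simp add: shifted_sum2_def harm2_def power2_eq_square)
next
  case (Suc m)
  have "harm2 (2 * Suc m + 1) = harm2 (2 * m + 1) + 1 / (2 * real m + 2)^2 + 1 / (2 * real m + 3)^2"
    using harm2_Suc[of "2 * m + 1"] harm2_Suc[of "2 * m + 2"] by (simp add: add_ac)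
  moreover have "shifted_sum2 (1/2) (Suc (Suc m))
      = shifted_sum2 (1/2) (Suc m) + 4 / (2 * real m + 3)^2"
    by (simp add: shifted_sum2_Suc[of _ "Suc m"] field_simps power2_eq_square)
  moreover have "4 / (2 * real m + 2)^2 = 1 / (real m + 1)^2"
    by (simp add: divide_simps power2_eq_square) algebra
  ultimately show ?case
    using Suc.IH harm2_Suc[of m] by argo
qed

text \<open>The value at t = 0 of the numerator of F, without the sign (-1)^n. The relative
  t^2-coefficient of that numerator is \<open>- harm2 k\<close>, hence the differences with
  \<open>harm2 k\<close> in \<open>wz_F\<close> and \<open>wz_G\<close>.\<close>

definition wz_weight :: "nat \<Rightarrow> real" where
  "wz_weight k = (-1)^k * fact (2 * k) * fact k ^ 2"

definition wz_poly :: "real \<Rightarrow> nat \<Rightarrow> real" where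
  "wz_poly x k = (x^2 + 3 * (2 * k + 1) * x + (2 * k + 1) * (5 * k + 3)) / 2"

definition wz_F :: "real \<Rightarrow> nat \<Rightarrow> real" where
  "wz_F x k = wz_weight k / pochhammer x (2 * k + 1) ^ 2
     * (shifted_sum2 x (2 * k + 1) - harm2 k)"

definition wz_G :: "real \<Rightarrow> nat \<Rightarrow> real" where
  "wz_G x k = wz_weight k / pochhammer x (2 * k + 2) ^ 2
     * (wz_poly x k * (shifted_sum2 x (2 * k + 2) - harm2 k) - 1 / 2)"

lemma wz_weight_Suc:
  "wz_weight (Suc k) = - wz_weight k * ((2 * real k + 1) * (2 * real k + 2) * (real k + 1)^2)"
  by (simp add: wz_weight_def algebra_simps power2_eq_square)

text \<open>The sum on the right replaces the difference of the WZ equation because (-1)^n, which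
  changes sign from n to n + 1, has been divided out. After removal of a common factor both sides
  are affine in a single harmonic expression \<open>S\<close>, so two polynomial identities
  suffice.\<close>

lemma wz_F_diff:
  assumes x: "x > 0"
  shows "wz_F x k - wz_F x (Suc k) = wz_G x k + wz_G (x + 1) k"
proof -
  define K where "K = real k"
  define a where "a = x"
  define b where "b = x + 2 * K + 1"
  define c where "c = x + 2 * K + 2"
  define P where "P = pochhammer x (2 * k + 1)"
  define P' where "P' = pochhammer (x + 1) (2 * k + 2)"
  define H where "H = harm2 k"
  define S where "S = shifted_sum2 x (2 * k + 3) - H"
  define C where "C = wz_weight k"
  define r where "r = (2 * K + 1) * (2 * K + 2)"
  have pos: "a > 0" "b > 0" "c > 0" "K \<ge> 0" "P > 0" "P' > 0"
    using x by (auto simp: a_def b_def c_def K_def P_def P'_def intro!: pochhammer_pos)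
  have p2: "pochhammer x (2 * k + 2) = P * b"
    using pochhammer_Suc[of x "2 * k + 1"] by (simp add: P_def b_def K_def add_ac)
  have p3: "pochhammer x (2 * k + 3) = P * b * c"
    using pochhammer_Suc[of x "2 * k + 2"] p2 by (simp add: c_def K_def add_ac eval_nat_numeral)
  have p3': "P * b * c = a * P'"
    using pochhammer_rec[of x "2 * k + 2"] p3 by (simp add: P'_def a_def eval_nat_numeral)
  have s3: "shifted_sum2 x (2 * k + 3) = shifted_sum2 x (2 * k + 2) + 1 / c^2"
    using shifted_sum2_Suc[of x "2 * k + 2"] by (simp add: c_def K_def add_ac eval_nat_numeral)
  have s2: "shifted_sum2 x (2 * k + 2) = shifted_sum2 x (2 * k + 1) + 1 / b^2"
    using shifted_sum2_Suc[of x "2 * k + 1"] by (simp add: b_def K_def add_ac)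
  have s3': "shifted_sum2 x (2 * k + 3) = 1 / a^2 + shifted_sum2 (x + 1) (2 * k + 2)"
    using shifted_sum2_rec[of x "2 * k + 2"] by (simp add: a_def eval_nat_numeral)
  \<comment> \<open>The common denominator is the square of \<open>pochhammer x (2 * k + 3)\<close>,
    the longest product that occurs. By \<open>p3'\<close> it also serves for the term at
    \<open>x + 1\<close>.\<close>
  define Q where "Q = C / (P * b * c)^2"
  have f1: "wz_F x k = Q * (b^2 * c^2 * (S - 1 / b^2 - 1 / c^2))"
    using pos s2 s3 unfolding wz_F_def P_def[symmetric] Q_def S_def
    by (simp add: C_def[symmetric] H_def[symmetric] power_mult_distrib)
  have hS: "harm2 (Suc k) = H + 1 / (K + 1)^2"
    by (simp add: H_def K_def harm2_Suc)
  have wS: "wz_weight (Suc k) = - C * (r * (K + 1)^2)"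
    by (simp add: C_def K_def r_def wz_weight_Suc)
  have e3: "2 * Suc k + 1 = 2 * k + 3" by simp
  have f2: "wz_F x (Suc k) = - Q * (r * (K + 1)^2 * (S - 1 / (K + 1)^2))"
    unfolding wz_F_def e3 p3 hS wS by (simp add: Q_def S_def)
  have g1: "wz_G x k = Q * (c^2 * (wz_poly x k * (S - 1 / c^2) - 1 / 2))"
    using pos s3 unfolding wz_G_def p2 Q_def S_def
    by (simp add: C_def[symmetric] H_def[symmetric] power_mult_distrib)
  have g2: "wz_G (x + 1) k = Q * (a^2 * (wz_poly (x + 1) k * (S - 1 / a^2) - 1 / 2))"
    using pos s3' unfolding wz_G_def P'_def[symmetric] Q_def p3' S_def
    by (simp add: C_def[symmetric] H_def[symmetric] power_mult_distrib)
  \<comment> \<open>\<open>main\<close> and \<open>side\<close> are the t^0 and t^2 coefficients,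
    the latter up to sign, of the WZ equation with denominators cleared: (b^2 - t^2) (c^2 - t^2) + r
    ((K + 1)^2 - t^2) = (c^2 - t^2) (q(x) - t^2/2) + (a^2 - t^2) (q(x + 1) - t^2/2), where q(x) is
    \<open>wz_poly x k\<close>. The t^4 coefficients agree as 1 = 1/2 + 1/2.\<close>
  have main: "b^2 * c^2 + r * (K + 1)^2 = c^2 * wz_poly x k + a^2 * wz_poly (x + 1) k"
    unfolding a_def b_def c_def r_def wz_poly_def K_def[symmetric]
    by (simp add: field_simps power2_eq_square)
  have side: "c^2 + b^2 + r = wz_poly x k + wz_poly (x + 1) k + (a^2 + c^2) / 2"
    unfolding a_def b_def c_def r_def wz_poly_def K_def[symmetric]
    by (simp add: field_simps power2_eq_square)
  have "b^2 * c^2 * (S - 1 / b^2 - 1 / c^2) + r * (K + 1)^2 * (S - 1 / (K + 1)^2)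
      = (b^2 * c^2 + r * (K + 1)^2) * S - (c^2 + b^2 + r)"
    using pos by (simp add: right_diff_distrib distrib_right)
  also have "\<dots> = c^2 * (wz_poly x k * (S - 1 / c^2) - 1 / 2)
        + a^2 * (wz_poly (x + 1) k * (S - 1 / a^2) - 1 / 2)"
    unfolding main side using pos
    by (simp add: right_diff_distrib distrib_right add_divide_distrib)
  finally have "b^2 * c^2 * (S - 1 / b^2 - 1 / c^2) + r * (K + 1)^2 * (S - 1 / (K + 1)^2)
      = c^2 * (wz_poly x k * (S - 1 / c^2) - 1 / 2)
        + a^2 * (wz_poly (x + 1) k * (S - 1 / a^2) - 1 / 2)" .
  then show ?thesis
    unfolding f1 f2 g1 g2 by (simp add: distrib_left[symmetric])
qed

section \<open>Bounds for convergence\<close>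

lemma harm2_le: "0 \<le> harm2 k" "harm2 k \<le> real k"
proof -
  show "0 \<le> harm2 k" by (simp add: harm2_def sum_nonneg)
  have "harm2 k \<le> (\<Sum>j=1..k. 1)"
    unfolding harm2_def by (rule sum_mono) (simp add: divide_le_eq)
  then show "harm2 k \<le> real k" by simp
qed

lemma shifted_sum2_le:
  assumes "x \<ge> 1 / 2"
  shows "0 \<le> shifted_sum2 x m" "shifted_sum2 x m \<le> 4 * real m"
proof -
  show "0 \<le> shifted_sum2 x m" by (simp add: shifted_sum2_def sum_nonneg)
  have "1 / (x + real j)^2 \<le> 4" for j
  proof -
    have "(1/2)^2 \<le> (x + real j)^2"
      using assms by (intro power_mono) auto
    then have "1 / (x + real j)^2 \<le> 1 / (1/2)^2"
      by (intro divide_left_mono) (use assms in \<open>auto simp: power2_eq_square\<close>)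
    then show ?thesis by (simp add: power2_eq_square)
  qed
  then have "shifted_sum2 x m \<le> (\<Sum>j<m. 4)"
    unfolding shifted_sum2_def by (intro sum_mono) auto
  then show "shifted_sum2 x m \<le> 4 * real m" by simp
qed

lemma pochhammer_ge_mult_fact:
  fixes x :: real
  assumes "x > 0"
  shows "x * fact m \<le> pochhammer x (Suc m)"
proof -
  have "fact m \<le> pochhammer (x + 1) m"
    unfolding pochhammer_fact pochhammer_prod using assms by (intro prod_mono) auto
  then show ?thesis
    using assms by (simp add: pochhammer_rec)
qed

text \<open>A lower bound 2^k for the central binomial coefficient. It supplies the geometric decay
  in k of \<open>wz_F\<close>.\<close>

lemma fact_sq_le: "2 ^ k * fact k ^ 2 \<le> (fact (2 * k) :: real)"
proof (induction k)
  case (Suc k)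
  have "2 ^ Suc k * fact (Suc k) ^ 2 = (2 * (real k + 1)^2) * (2 ^ k * fact k ^ 2)"
    by (simp add: power2_eq_square algebra_simps)
  also have "\<dots> \<le> ((2 * real k + 1) * (2 * real k + 2)) * fact (2 * k)"
    by (rule mult_mono[OF _ Suc.IH]) (auto simp: power2_eq_square algebra_simps)
  also have "\<dots> = fact (2 * Suc k)"
    by (simp add: algebra_simps)
  finally show ?case .
qed simp

text \<open>One factor (2 k)! in the weight faces two in the squared Pochhammer symbol, which leaves
  (k!)^2 / (2 k)!, at most 1 / 2^k. The harmonic bracket grows only linearly: 4 (2 k + 1) + k = 9 k
  + 4. The bound separates x from k, as \<open>wz_sums\<close> requires.\<close>

lemma wz_F_bound:
  assumes x: "x \<ge> 1 / 2"
  shows "\<bar>wz_F x k\<bar> \<le> 1 / x^2 * ((9 * real k + 4) / 2 ^ k)"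
proof -
  define P where "P = pochhammer x (2 * k + 1)"
  define f where "f = (fact (2 * k) :: real)"
  have xf: "x * f \<le> P" "f > 0"
    using pochhammer_ge_mult_fact[of x "2 * k"] x by (auto simp: P_def f_def)
  have P: "P > 0" using x by (auto simp: P_def intro!: pochhammer_pos)
  have "\<bar>wz_weight k\<bar> = f * fact k ^ 2"
    by (simp add: wz_weight_def abs_mult f_def power_abs)
  also have "\<dots> \<le> f * (f / 2 ^ k)"
    using fact_sq_le[of k] xf by (intro mult_left_mono) (auto simp: f_def field_simps)
  also have "\<dots> = 1 / x^2 * (1 / 2 ^ k) * (x * f)^2"
    using x by (simp add: power2_eq_square)
  also have "\<dots> \<le> 1 / x^2 * (1 / 2 ^ k) * P^2"
    using xf x by (intro mult_left_mono power_mono) auto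
  finally have 1: "\<bar>wz_weight k / P^2\<bar> \<le> 1 / x^2 * (1 / 2 ^ k)"
    using P by (simp add: divide_le_eq)
  have 2: "\<bar>shifted_sum2 x (2 * k + 1) - harm2 k\<bar> \<le> 9 * real k + 4"
    using shifted_sum2_le[OF x, of "2 * k + 1"] harm2_le[of k] by (simp add: abs_le_iff)
  have "\<bar>wz_F x k\<bar> \<le> 1 / x^2 * (1 / 2 ^ k) * (9 * real k + 4)"
    unfolding wz_F_def P_def[symmetric] abs_mult by (rule mult_mono[OF 1 2]) auto
  then show ?thesis by simp
qed

text \<open>Only decay in x for fixed k is needed, so D may depend on k. The quadratic growth of
  \<open>wz_poly\<close> is absorbed by the factor (x + 1)^2 in the square of the Pochhammer symbol,
  and the factor x^2 remains.\<close>

lemma wz_G_bound: "\<exists>D. \<forall>x\<ge>1/2. \<bar>wz_G x k\<bar> \<le> D / x^2"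
proof -
  define K where "K = real k"
  have K: "K \<ge> 0" by (simp add: K_def)
  define A where "A = 2 * (1 + 3 * (2 * K + 1) + (2 * K + 1) * (5 * K + 3))"
  define M where "M = 9 * K + 8"
  define W where "W = \<bar>wz_weight k\<bar>"
  have "\<bar>wz_G x k\<bar> \<le> (W * (A * M + 1/2)) / x^2" if x: "x \<ge> 1/2" for x
  proof -
    have x1: "1 \<le> (x + 1)^2" "x \<le> (x + 1)^2" "x^2 \<le> (x + 1)^2"
      using x by (auto simp: power2_eq_square algebra_simps)
    have q0: "0 \<le> wz_poly x k"
      using x by (simp add: wz_poly_def)
    have "wz_poly x k \<le> x^2 + 3 * (2 * K + 1) * x + (2 * K + 1) * (5 * K + 3) * 1"
      using x by (simp add: wz_poly_def K_def)
    also have "\<dots> \<le> (x + 1)^2 + 3 * (2 * K + 1) * (x + 1)^2 + (2 * K + 1) * (5 * K + 3) * (x + 1)^2"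
      using x1 K by (intro add_mono mult_left_mono) auto
    also have "\<dots> = A / 2 * (x + 1)^2"
      by (simp add: A_def algebra_simps)
    also have "\<dots> \<le> A * (x + 1)^2"
      using K by (intro mult_right_mono) (auto simp: A_def)
    finally have q: "wz_poly x k \<le> A * (x + 1)^2" .
    have h: "\<bar>shifted_sum2 x (2 * k + 2) - harm2 k\<bar> \<le> M"
      using shifted_sum2_le[OF x, of "2 * k + 2"] harm2_le[of k] by (simp add: abs_le_iff M_def K_def)
    have "\<bar>wz_poly x k * (shifted_sum2 x (2 * k + 2) - harm2 k)\<bar> \<le> A * (x + 1)^2 * M"
      unfolding abs_mult using q q0 h by (intro mult_mono) auto
    then have 1: "\<bar>wz_poly x k * (shifted_sum2 x (2 * k + 2) - harm2 k) - 1 / 2\<bar>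
        \<le> (A * M + 1/2) * (x + 1)^2"
      using x1 by (simp add: abs_le_iff algebra_simps)
    have "x * (x + 1) \<le> pochhammer x (2 * k + 2)"
    proof -
      have "1 * (x + 1) \<le> fact (2 * k) * (x + 1)"
        using x by (intro mult_right_mono) auto
      also have "\<dots> \<le> pochhammer (x + 1) (Suc (2 * k))"
        using pochhammer_ge_mult_fact[of "x + 1" "2 * k"] x by (simp add: mult.commute)
      finally show ?thesis
        using x pochhammer_rec[of x "Suc (2 * k)"] by simp
    qed
    then have "(x * (x + 1))^2 \<le> pochhammer x (2 * k + 2) ^ 2"
      using x by (intro power_mono) auto
    then have 2: "\<bar>wz_weight k / pochhammer x (2 * k + 2) ^ 2\<bar> \<le> W / (x * (x + 1))^2"
      unfolding W_def abs_divide using x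
      by (intro divide_mono) auto
    have "\<bar>wz_G x k\<bar> \<le> W / (x * (x + 1))^2 * ((A * M + 1/2) * (x + 1)^2)"
      unfolding wz_G_def abs_mult by (rule mult_mono[OF 2 1]) (auto simp: W_def)
    also have "\<dots> = (W * (A * M + 1/2)) / x^2"
      using x by (simp add: power_mult_distrib)
    finally show ?thesis .
  qed
  then show ?thesis by blast
qed

lemma summable_half_inverse_square: "summable (\<lambda>n. 1 / (real n + 1/2)^2)"
proof -
  \<comment> \<open>Telescoping majorant with differences 8 / ((n + 1) (n + 2)); the constant 8
    gives equality at n = 0.\<close>
  define f where "f n = 8 * inverse (real (Suc n))" for n
  have "f \<longlonglongrightarrow> 0"
    unfolding f_def using tendsto_mult_right_zero[OF LIMSEQ_inverse_real_of_nat] .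
  then have "summable (\<lambda>n. f n - f (Suc n))"
    by (rule telescope_summable')
  then show ?thesis
  proof (rule summable_comparison_test'[where N = 0])
    fix n :: nat
    have "(real n + 1) * (real n + 2) \<le> 8 * (real n + 1/2)^2"
      by (simp add: power2_eq_square algebra_simps)
    then have "1 / (real n + 1/2)^2 \<le> 8 / ((real n + 1) * (real n + 2))"
      by (simp add: divide_simps mult.commute)
    also have "\<dots> = f n - f (Suc n)"
      by (simp add: f_def divide_simps) (simp add: algebra_simps)
    finally show "norm (1 / (real n + 1/2)^2) \<le> f n - f (Suc n)"
      by simp
  qed
qed

section \<open>Specialisation to x = 1/2\<close>

text \<open>Both sides have the same ratio \<open>- s\<close> of consecutive terms, and 16/9 is the
  value 1 / (1/2 * 3/2)^2 of the left side at k = 0. In essence this is the duplication formula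
  applied to (2 k)! and to (5/2)_{2k}.\<close>

lemma wz_weight_div_pochhammer:
  "wz_weight k / pochhammer (1/2) (2 * k + 2) ^ 2 = 16 / 9 * ((-1/4) ^ k
     * (pochhammer 1 k ^ 3 * pochhammer (1/2) k
        / (pochhammer (5/4) k ^ 2 * pochhammer (7/4) k ^ 2)))" (is "?L k = 16 / 9 * ?R k")
proof (induction k)
  case 0
  show ?case by (simp add: wz_weight_def pochhammer_rec power2_eq_square eval_nat_numeral)
next
  case (Suc k)
  define K where "K = real k"
  define s where "s = (2 * K + 1) * (2 * K + 2) * (K + 1)^2 / ((2 * K + 5/2) * (2 * K + 7/2))^2"
  have p: "pochhammer (1/2) (2 * Suc k + 2)
      = pochhammer (1/2) (2 * k + 2) * ((2 * K + 5/2) * (2 * K + 7/2))"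
    by (simp add: pochhammer_Suc K_def add_ac)
  have "?L (Suc k) = - s * ?L k"
    unfolding p wz_weight_Suc by (simp add: s_def K_def[symmetric] power_mult_distrib mult_ac)
  moreover have "?R (Suc k) = - s * ?R k"
  proof -
    have "?R (Suc k) = ?R k * ((-1/4) * ((1 + K)^3 * (1/2 + K) / ((5/4 + K)^2 * (7/4 + K)^2)))"
      by (simp add: pochhammer_Suc K_def[symmetric] power_mult_distrib mult_ac)
    also have "(1 + K)^3 * (1/2 + K) / ((5/4 + K)^2 * (7/4 + K)^2) = 4 * s"
    proof -
      have e: "(2 * K + 5/2) * (2 * K + 7/2) = 4 * ((5/4 + K) * (7/4 + K))"
        by (simp add: field_simps)
      have "(2 * K + 1) * (2 * K + 2) * (K + 1)^2 = 4 * ((1 + K)^3 * (1/2 + K))"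
        by (simp add: power2_eq_square power3_eq_cube algebra_simps)
      then show ?thesis
        unfolding s_def e by (simp add: power_mult_distrib)
    qed
    finally show ?thesis by simp
  qed
  ultimately show ?case using Suc.IH by (simp only: mult.left_commute)
qed

theorem theorem1p4:
  "(\<lambda>k::nat. (-1 / 4 :: real) ^ k
      * (pochhammer 1 k ^ 3 * pochhammer (1 / 2) k
         / (pochhammer (5 / 4) k ^ 2 * pochhammer (7 / 4) k ^ 2))
      * ((19 + 56 * real k + 40 * real k ^ 2)
           * (harm2 k + harm2 (1 + 2 * k) - 4 * harm2 (3 + 4 * k)) + 4))
   sums (- 72 * dirichlet_beta 4)"
  (is "?T sums _")
proof -
  define F where "F n k = (-1)^n * wz_F (real n + 1/2) k" for n k
  define G where "G n k = (-1)^n * wz_G (real n + 1/2) k" for n k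
  have "(\<lambda>k. G 0 k) sums (\<Sum>n. F n 0)"
  proof (rule wz_sums)
    fix n k
    show "F n k - F n (Suc k) = G n k - G (Suc n) k"
      using wz_F_diff[of "real n + 1/2" k]
      by (simp add: F_def G_def add_ac right_diff_distrib[symmetric] distrib_left[symmetric])
    show "\<bar>F n k\<bar> \<le> 1 / (real n + 1/2)^2 * ((9 * real k + 4) / 2 ^ k)"
      using wz_F_bound[of "real n + 1/2" k] by (simp add: F_def abs_mult)
  next
    show "summable (\<lambda>n. 1 / (real n + 1/2)^2)"
      by (rule summable_half_inverse_square)
    have "(\<lambda>k. 9 * (real k * (1/2)^k) + 4 * (1/2)^k) \<longlonglongrightarrow> 9 * 0 + 4 * 0"
      by (intro tendsto_intros powser_times_n_limit_0 LIMSEQ_realpow_zero) auto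
    then show "(\<lambda>k. (9 * real k + 4) / 2 ^ k) \<longlonglongrightarrow> 0"
      by (simp add: add_divide_distrib power_divide)
  next
    fix k
    obtain D where D: "\<And>x. x \<ge> 1/2 \<Longrightarrow> \<bar>wz_G x k\<bar> \<le> D / x^2"
      using wz_G_bound by blast
    have "\<bar>G n k\<bar> \<le> \<bar>D * (1 / (real n + 1/2)^2)\<bar>" for n
      using order_trans[OF D abs_ge_self, of "real n + 1/2"] by (simp add: G_def abs_mult)
    then have le: "norm (G n k) \<le> norm (D * (1 / (real n + 1/2)^2)) * 1" for n
      by simp
    have "(\<lambda>n. D * (1 / (real n + 1/2)^2)) \<longlonglongrightarrow> 0"
      using tendsto_mult_right_zero[OF summable_LIMSEQ_zero[OF summable_half_inverse_square]] .
    then show "(\<lambda>n. G n k) \<longlonglongrightarrow> 0"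
      by (rule tendsto_0_le[OF _ always_eventually]) (use le in blast)
  qed
  \<comment> \<open>The factor -2/9 is 16/9 from the prefactor times -1/8: the polynomial of the
    theorem is 8 times \<open>wz_poly (1/2) k\<close>, and the harmonic bracket enters with the
    opposite sign.\<close>
  moreover have "G 0 k = - 2 / 9 * ?T k" for k
  proof -
    define H where "H = harm2 k + harm2 (1 + 2 * k) - 4 * harm2 (3 + 4 * k)"
    have 1: "shifted_sum2 (1/2) (2 * k + 2) - harm2 k = - H"
      using shifted_sum2_half[of "2 * k + 1"] by (simp add: H_def add_ac eval_nat_numeral)
    have 2: "wz_poly (1/2) k = (19 + 56 * real k + 40 * real k ^ 2) / 8"
      by (simp add: wz_poly_def field_simps power2_eq_square)
    have 3: "16 / 9 * R * (p / 8 * - H - 1 / 2) = - 2 / 9 * (R * (p * H + 4))" for R p :: real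
      by (simp add: field_simps)
    show ?thesis
      unfolding G_def wz_G_def H_def[symmetric] of_nat_0 add_0 wz_weight_div_pochhammer 1 2 3
      by simp
  qed
  \<comment> \<open>At k = 0 the function \<open>wz_F x\<close> reduces to 1 / x^4, and x = (2 n +
    1) / 2 produces the factor 16.\<close>
  moreover have "(\<Sum>n. F n 0) = 16 * dirichlet_beta 4"
  proof -
    have F0: "F n 0 = 16 * ((-1) ^ n / real (1 + 2 * n) ^ 4)" for n
    proof -
      have "real n + 1/2 = real (1 + 2 * n) / 2" by simp
      then show ?thesis
        unfolding F_def wz_F_def
        by (simp only:) (simp add: wz_weight_def shifted_sum2_def harm2_def power_divide
          flip: power_add)
    qed
    have "summable (\<lambda>n. (-1) ^ n / real (1 + 2 * n) ^ 4)"
    proof (rule summable_comparison_test'[OF summable_half_inverse_square, of 0])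
      fix n :: nat
      have "(real n + 1/2)^2 \<le> real (1 + 2 * n) ^ 2"
        by (intro power_mono) auto
      also have "\<dots> \<le> real (1 + 2 * n) ^ 4"
        by (intro power_increasing) auto
      finally have "1 / real (1 + 2 * n) ^ 4 \<le> 1 / (real n + 1/2)^2"
        by (intro divide_left_mono) auto
      then show "norm ((-1) ^ n / real (1 + 2 * n) ^ 4) \<le> 1 / (real n + 1/2)^2"
        by (simp add: power_abs)
    qed
    then show ?thesis
      unfolding F0 dirichlet_beta_def by (rule suminf_mult)
  qed
  ultimately have "(\<lambda>k. - 2 / 9 * ?T k) sums (16 * dirichlet_beta 4)"
    by simp
  \<comment> \<open>Clearing the factor -2/9 turns 16 into 16 * (-9/2) = -72.\<close>
  from sums_mult[OF this, of "- 9 / 2"] show ?thesis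
    unfolding mult.assoc[symmetric, of "- 9 / 2 :: real"] by (simp add: mult.assoc)
qed

end
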